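(* Let $r\ge 1$ be an integer and let $\mu>0$. If, as $n\to\infty$, $$n^{r+1}\,\mathbb{E}\,p_{X_n}^r\to (r+1)!\,\mu \qquad\text{and}\qquad n\,p_n^*\to 0,$$ then $V_{n,r}\stackrel{d}{\to}\mathrm{Pois}(\mu)$ as $n\to\infty$.
   Context: Model. For every $n\ge 1$, let $X_{n,1},\ldots,X_{n,n}$ be iid random variables with values in a (finite or infinite) set $M_n\subset\mathbb{N}=\{1,2,\ldots\}$, with common distribution $p_{n,m}=\mathbb{P}(X_{n,1}=m)$, $m\in M_n$ ($X_{n,j}$ is the box selected for the $j$th of $n$ balls). For $k\in\{1,\ldots,n+1\}$ and $m\in M_n$ let $N_{n,k}(m)=\sum_{j=1}^{k-1} I_{\{X_{n,j}=m\}}$, where $I_{\{\cdot\}}$ denotes an indicator. Given a positive integer $r$ (the capacity of each box), let $Y_{n,k}=\sum_{m\in M_n} I_{\{X_{n,k}=m\}}I_{\{N_{n,k}(m)\ge r\}}$ for $k=1,\ldots,n$, and define the overflow $V_{n,r}=\sum_{k=1}^n Y_{n,k}$. Notation. $p_n^*=\sup_{m\in M_n}p_{n,m}$. $X_n$ denotes a random variable such that $X_n,X_{n,1},\ldots,X_{n,n}$ are iid, and $p_{X_n}$ stands for $p_{n,X_n}$; thus $\mathbb{E}\,p_{X_n}^s=\sum_{m\in M_n}p_{n,m}^{s+1}$. $\mathrm{Pois}(\mu)$ is the Poisson distribution with parameter $\mu$, and $\stackrel{d}{\to}$ is convergence in distribution. *)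

theory Defs
  imports "HOL-Probability.Probability"
begin

text \<open>
  One row of the triangular array: \<open>n\<close> balls thrown independently and with a common law
  into boxes labelled by \<open>M\<close>; \<open>X j\<close> is the box of ball \<open>j\<close>, for \<open>j = 1, \<dots>, n\<close>. The values of
  \<open>X\<close> outside \<open>{1..n}\<close> are irrelevant. Measurability is part of \<open>indep_vars\<close>.
\<close>

locale ball_allocation = prob_space P for P :: "'a measure" +
  fixes n :: nat and M :: "nat set" and X :: "nat \<Rightarrow> 'a \<Rightarrow> nat"
  assumes labels: "M \<subseteq> {1..}"
    and values_in: "\<And>j \<omega>. j \<in> {1..n} \<Longrightarrow> \<omega> \<in> space P \<Longrightarrow> X j \<omega> \<in> M"
    and indep: "indep_vars (\<lambda>_. count_space UNIV) X {1..n}"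
    and identically_distributed: "\<And>j. j \<in> {1..n} \<Longrightarrow>
      distr P (count_space UNIV) (X j) = distr P (count_space UNIV) (X 1)"

definition box_law :: "'a measure \<Rightarrow> (nat \<Rightarrow> 'a \<Rightarrow> nat) \<Rightarrow> nat measure" where
  "box_law P X = distr P (count_space UNIV) (X 1)"

definition box_prob :: "'a measure \<Rightarrow> (nat \<Rightarrow> 'a \<Rightarrow> nat) \<Rightarrow> nat \<Rightarrow> real" where
  "box_prob P X m = measure P {\<omega> \<in> space P. X 1 \<omega> = m}"

definition max_box_prob :: "'a measure \<Rightarrow> nat set \<Rightarrow> (nat \<Rightarrow> 'a \<Rightarrow> nat) \<Rightarrow> real" where
  "max_box_prob P M X = (SUP m\<in>M. box_prob P X m)"

text \<open>
  \<open>E p\<^sub>Z\<^sup>s\<close> for a further box choice \<open>Z\<close> with the common law. It depends on the law of \<open>Z\<close>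
  only, so it is an integral against that law and \<open>Z\<close> need not live on \<open>P\<close>.
\<close>

definition box_prob_moment :: "'a measure \<Rightarrow> (nat \<Rightarrow> 'a \<Rightarrow> nat) \<Rightarrow> nat \<Rightarrow> real" where
  "box_prob_moment P X s = (\<integral>m. box_prob P X m ^ s \<partial>box_law P X)"

definition load_before :: "(nat \<Rightarrow> 'a \<Rightarrow> nat) \<Rightarrow> nat \<Rightarrow> nat \<Rightarrow> 'a \<Rightarrow> nat" where
  "load_before X k m \<omega> = (\<Sum>j\<in>{1..<k}. of_bool (X j \<omega> = m))"

text \<open>\<open>M\<close> may be infinite, hence \<open>infsum\<close>: the finite sum operator would then be \<open>0\<close>.\<close>

definition overflows :: "nat set \<Rightarrow> (nat \<Rightarrow> 'a \<Rightarrow> nat) \<Rightarrow> nat \<Rightarrow> nat \<Rightarrow> 'a \<Rightarrow> nat" where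
  "overflows M X r k \<omega> =
     (\<Sum>\<^sub>\<infinity>m\<in>M. of_bool (X k \<omega> = m) * of_bool (load_before X k m \<omega> \<ge> r))"

definition overflow :: "nat set \<Rightarrow> (nat \<Rightarrow> 'a \<Rightarrow> nat) \<Rightarrow> nat \<Rightarrow> nat \<Rightarrow> 'a \<Rightarrow> nat" where
  "overflow M X n r \<omega> = (\<Sum>k=1..n. overflows M X r k \<omega>)"

end

(* The overflow V agrees with the number W of (r+1)-element sets of balls that share a box, unless
   some r+2 balls share a box, which is unlikely since n p* -> 0. The events counted by W are
   independent for disjoint sets of balls, and E W -> mu. As in the Chen-Stein method, decoupling
   each event from those that meet it shows that the characteristic function phi of W nearly solves
   phi'(t) = i mu e^(it) phi(t), the equation of the Poisson law. Levy's continuity theorem concludes. *)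

theory Submission
  imports Defs
begin

text \<open>Whether a ball overflows depends on all earlier balls, so the overflow offers no
  independence to exploit; sets of \<open>r + 1\<close> balls do. In the equation for the
  characteristic function, \<open>iexp s\<close> is the phase that an event adds to W when it
  occurs. The defect is at most \<open>\<bar>s\<bar>\<close> times two sums over pairs of sets S, T
  that meet, and both are controlled by the size u of the union of S and T. Products of
  probabilities: there are O(n^u) such pairs, each probability has order n^-(r+1), and u is at most
  2r+1, so a factor 1/n remains. Joint probabilities: two sets that meet both lie in one box exactly
  when their union does. Each of the u-1-r balls beyond \<open>r + 1\<close> brings a factor n for
  its choice and at most the largest box probability for its position. As u is at least r+2, a
  positive power of a null sequence appears. The case u = r+2 also disposes of the exceptional event
  on which V and W differ.\<close>

section \<open>Characteristic functions and the perturbed Poisson equation\<close>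

lemma norm_iexp_diff_le: "cmod (iexp x - iexp y) \<le> \<bar>x - y\<bar>"
proof -
  have "iexp x - iexp y = iexp y * (iexp (x - y) - 1)"
    by (simp add: algebra_simps flip: exp_add)
  then have "cmod (iexp x - iexp y) = cmod (iexp (x - y) - 1)"
    by (simp add: norm_mult)
  also have "\<dots> \<le> \<bar>x - y\<bar>"
    using iexp_approx1[of "x - y" 0] by simp
  finally show ?thesis .
qed

lemma norm_exp_le: "cmod (exp (of_real l * (iexp s - 1))) \<le> 1" if "l \<ge> 0"
proof -
  have "Re (of_real l * (iexp s - 1)) = l * (cos s - 1)" by (simp add: Re_exp)
  also have "\<dots> \<le> 0" using that cos_le_one[of s] by (simp add: mult_nonneg_nonpos)
  finally show ?thesis by (simp add: norm_exp_eq_Re)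
qed

lemma norm_exp_neg_le: "cmod (exp (- (of_real l * (iexp s - 1)))) \<le> exp (2 * l)" if "l \<ge> 0"
proof -
  have "Re (- (of_real l * (iexp s - 1))) = l * (1 - cos s)"
    by (simp add: Re_exp algebra_simps)
  also have "\<dots> \<le> l * 2" using that cos_ge_minus_one[of s] by (intro mult_left_mono) auto
  finally show ?thesis unfolding norm_exp_eq_Re by (simp add: mult.commute)
qed

text \<open>Stability of the Poisson equation. The integrating factor has norm at most
  \<open>exp (2 * l)\<close>, because \<open>1 - cos s\<close> is at most 2. One factor
  \<open>\<bar>t\<bar>\<close> comes from the defect bound and another from the length of the
  segment in the mean value inequality.\<close>

lemma norm_diff_poisson_char_le:
  fixes \<phi> \<phi>' :: "real \<Rightarrow> complex"
  assumes deriv: "\<And>s. (\<phi> has_vector_derivative \<phi>' s) (at s)"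
    and "\<phi> 0 = 1" and l: "l \<ge> 0" and "b \<ge> 0"
    and bound: "\<And>s. cmod (\<phi>' s - \<i> * of_real l * iexp s * \<phi> s) \<le> \<bar>s\<bar> * b"
  shows "cmod (\<phi> t - exp (of_real l * (iexp t - 1))) \<le> exp (2 * l) * t\<^sup>2 * b"
proof -
  (* Dividing by the Poisson characteristic function, the solution of the equation with zero right-hand side. *)
  define e where "e s = exp (- (of_real l * (iexp s - 1)))" for s
  define \<psi> where "\<psi> s = \<phi> s * e s" for s
  define d where "d s = e s * (\<phi>' s - \<i> * of_real l * iexp s * \<phi> s)" for s
  have de: "(e has_vector_derivative - (\<i> * of_real l * iexp s * e s)) (at s)" for s
    unfolding e_def
    by (auto intro!: derivative_eq_intros has_vector_derivative_real_field simp: algebra_simps)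
  have d\<psi>: "(\<psi> has_vector_derivative d s) (at s)" for s
    unfolding \<psi>_def d_def
    by (rule derivative_eq_intros deriv de refl)+ (simp add: algebra_simps)
  have "cmod (\<psi> t - \<psi> 0) \<le> (exp (2 * l) * (\<bar>t\<bar> * b)) * norm (t - 0)"
  proof (rule differentiable_bound[where S = "closed_segment 0 t" and f' = "\<lambda>s x. x *\<^sub>R d s"])
    show "(\<psi> has_derivative (\<lambda>x. x *\<^sub>R d s)) (at s within closed_segment 0 t)" for s
      using d\<psi>[of s] unfolding has_vector_derivative_def by (rule has_derivative_at_withinI)
    fix s assume "s \<in> closed_segment 0 t"
    then have s: "\<bar>s\<bar> \<le> \<bar>t\<bar>" by (auto simp: closed_segment_eq_real_ivl split: if_splits)
    have "cmod (d s) \<le> exp (2 * l) * (\<bar>s\<bar> * b)"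
      unfolding d_def norm_mult e_def
      by (intro mult_mono norm_exp_neg_le bound l) auto
    also have "\<dots> \<le> exp (2 * l) * (\<bar>t\<bar> * b)"
      using s \<open>b \<ge> 0\<close> by (intro mult_left_mono mult_right_mono) auto
    finally show "onorm (\<lambda>x. x *\<^sub>R d s) \<le> exp (2 * l) * (\<bar>t\<bar> * b)"
      by (intro onorm_le) (simp add: mult.commute mult_left_mono)
  qed auto
  then have 1: "cmod (\<psi> t - 1) \<le> exp (2 * l) * t\<^sup>2 * b"
    using abs_mult_self_eq[of t] by (simp add: \<psi>_def e_def \<open>\<phi> 0 = 1\<close> power2_eq_square mult_ac)
  \<comment> \<open>Undoing the division costs nothing, since a Poisson characteristic function has
    norm at most 1.\<close>
  have "\<phi> t - exp (of_real l * (iexp t - 1)) = exp (of_real l * (iexp t - 1)) * (\<psi> t - 1)"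
    using exp_minus_inverse[of "of_real l * (iexp t - 1)"]
    by (simp add: \<psi>_def e_def algebra_simps)
  then have "cmod (\<phi> t - exp (of_real l * (iexp t - 1))) \<le> 1 * cmod (\<psi> t - 1)"
    unfolding norm_mult[symmetric] using norm_exp_le[OF l, of t]
    by (metis mult_right_mono norm_ge_zero norm_mult)
  with 1 show ?thesis by simp
qed

lemma char_poisson:
  assumes "\<mu> > 0"
  shows "char (distr (measure_pmf (poisson_pmf \<mu>)) borel real) t = exp (of_real \<mu> * (iexp t - 1))"
proof -
  have int: "integrable (count_space UNIV) (\<lambda>k. pmf (poisson_pmf \<mu>) k *\<^sub>R iexp (t * real k))"
    by (rule Bochner_Integration.integrable_bound[OF integrable_pmf[of UNIV "poisson_pmf \<mu>"]]) auto
  have "char (distr (measure_pmf (poisson_pmf \<mu>)) borel real) t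
      = (\<integral>k. iexp (t * real k) \<partial>measure_pmf (poisson_pmf \<mu>))"
    unfolding char_def by (subst integral_distr) auto
  also have "\<dots> = (\<integral>k. pmf (poisson_pmf \<mu>) k *\<^sub>R iexp (t * real k) \<partial>count_space UNIV)"
    unfolding measure_pmf_eq_density by (subst integral_density) auto
  finally have "(\<lambda>k. pmf (poisson_pmf \<mu>) k *\<^sub>R iexp (t * real k)) sums
      char (distr (measure_pmf (poisson_pmf \<mu>)) borel real) t"
    using sums_integral_count_space_nat[OF int] by simp
  moreover have "(\<lambda>k. of_real (exp (- \<mu>)) * ((of_real \<mu> * iexp t) ^ k /\<^sub>R fact k)) sums
      (of_real (exp (- \<mu>)) * exp (of_real \<mu> * iexp t))"
    by (intro sums_mult exp_converges)
  moreover have "pmf (poisson_pmf \<mu>) k *\<^sub>R iexp (t * real k)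
      = of_real (exp (- \<mu>)) * ((of_real \<mu> * iexp t) ^ k /\<^sub>R fact k)" for k
    using assms
    by (simp add: scaleR_conv_of_real power_mult_distrib mult_ac divide_inverse flip: exp_of_nat_mult)
  ultimately have "char (distr (measure_pmf (poisson_pmf \<mu>)) borel real) t
      = of_real (exp (- \<mu>)) * exp (of_real \<mu> * iexp t)"
    using sums_unique2 by auto
  also have "\<dots> = exp (of_real \<mu> * (iexp t - 1))"
    by (simp add: right_diff_distrib exp_diff exp_minus divide_inverse mult.commute exp_of_real)
  finally show ?thesis .
qed

section \<open>Poisson approximation for sums of locally dependent indicators\<close>

lemma norm_integral_le_integral:
  fixes f :: "'a \<Rightarrow> 'b::{banach, second_countable_topology}"
  assumes "integrable M f" "integrable M g" "\<And>x. x \<in> space M \<Longrightarrow> norm (f x) \<le> g x"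
  shows "norm (\<integral>x. f x \<partial>M) \<le> (\<integral>x. g x \<partial>M)"
  using assms by (intro order_trans[OF integral_norm_bound integral_mono]) auto

context prob_space begin

text \<open>A bounded natural-valued variable takes finitely many values, so the integral is a
  finite trigonometric sum and may be differentiated term by term, without an argument for
  exchanging limit and integral.\<close>

lemma has_vector_derivative_char_nat:
  fixes W :: "'a \<Rightarrow> nat"
  assumes W[measurable]: "W \<in> measurable M (count_space UNIV)" and le: "\<And>\<omega>. W \<omega> \<le> N"
  shows "((\<lambda>s. \<integral>\<omega>. iexp (s * real (W \<omega>)) \<partial>M) has_vector_derivative
          (\<integral>\<omega>. \<i> * of_nat (W \<omega>) * iexp (s * real (W \<omega>)) \<partial>M)) (at s)"
proof -
  have *: "(\<integral>\<omega>. h (W \<omega>) \<partial>M) = (\<Sum>k\<le>N. prob {\<omega>\<in>space M. W \<omega> = k} *\<^sub>R h k)" for h :: "nat \<Rightarrow> complex"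
  proof -
    have "(\<integral>\<omega>. h (W \<omega>) \<partial>M)
        = (\<integral>\<omega>. (\<Sum>k\<le>N. indicator {\<omega>\<in>space M. W \<omega> = k} \<omega> *\<^sub>R h k) \<partial>M)"
    proof (rule Bochner_Integration.integral_cong[OF refl])
      fix \<omega> assume "\<omega> \<in> space M"
      then have "(\<Sum>k\<le>N. indicator {\<omega>\<in>space M. W \<omega> = k} \<omega> *\<^sub>R h k) = (\<Sum>k\<in>{W \<omega>}. h k)"
        using le[of \<omega>] by (intro sum.mono_neutral_cong_right) (auto simp: indicator_def)
      then show "h (W \<omega>) = (\<Sum>k\<le>N. indicator {\<omega>\<in>space M. W \<omega> = k} \<omega> *\<^sub>R h k)" by simp
    qed
    also have "\<dots> = (\<Sum>k\<le>N. prob {\<omega>\<in>space M. W \<omega> = k} *\<^sub>R h k)"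
      by (subst Bochner_Integration.integral_sum) (auto simp: emeasure_eq_measure intro!: integrable_scaleR_left)
    finally show ?thesis .
  qed
  have "((\<lambda>s. \<Sum>k\<le>N. prob {\<omega>\<in>space M. W \<omega> = k} *\<^sub>R iexp (s * real k)) has_vector_derivative
      (\<Sum>k\<le>N. prob {\<omega>\<in>space M. W \<omega> = k} *\<^sub>R (\<i> * of_nat k * iexp (s * real k)))) (at s)"
    by (auto intro!: derivative_eq_intros has_vector_derivative_real_field sum.cong simp: algebra_simps)
  then show ?thesis
    using *[of "\<lambda>k. \<i> * of_nat k * iexp (s * real k)"] *[of "\<lambda>k. iexp (u * real k)" for u]
    by simp
qed

text \<open>\<open>B a\<close> is the dependency neighbourhood of \<open>a\<close>, and the two
  double sums are the classical Chen-Stein quantities b1 and b2. The first keeps the diagonal terms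
  \<open>p a * p a\<close>, the second omits them; the usual third quantity is absent because
  independence outside \<open>B a\<close> is exact. The derivative of the characteristic function is
  a sum over \<open>a\<close> of integrals of an indicator times \<open>iexp (s * W)\<close>, up to
  the factor \<open>\<i>\<close>, so the equation can be checked one index at a time.\<close>

lemma dependent_sum_char_bound:
  fixes Q :: "'i \<Rightarrow> 'a \<Rightarrow> bool" and A :: "'i set" and B :: "'i \<Rightarrow> 'i set"
  assumes A: "finite A"
    and meas: "\<And>a. a \<in> A \<Longrightarrow> Measurable.pred M (Q a)"
    and B: "\<And>a. a \<in> A \<Longrightarrow> a \<in> B a \<and> B a \<subseteq> A"
    and indep: "\<And>a. a \<in> A \<Longrightarrow> indep_var borel (\<lambda>\<omega>. of_bool (Q a \<omega>) :: real)
        borel (\<lambda>\<omega>. \<Sum>b\<in>A - B a. of_bool (Q b \<omega>) :: real)"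
  defines "p \<equiv> \<lambda>a. prob {\<omega>\<in>space M. Q a \<omega>}"
  defines "W \<equiv> \<lambda>\<omega>. \<Sum>a\<in>A. of_bool (Q a \<omega>) :: real"
  shows "cmod (char (distr M borel W) t - exp (of_real (\<Sum>a\<in>A. p a) * (iexp t - 1)))
    \<le> exp (2 * (\<Sum>a\<in>A. p a)) * t\<^sup>2 *
       ((\<Sum>a\<in>A. \<Sum>b\<in>B a. p a * p b) +
        (\<Sum>a\<in>A. \<Sum>b\<in>B a - {a}. prob {\<omega>\<in>space M. Q a \<omega> \<and> Q b \<omega>}))"
    (is "_ \<le> _ * (?b1 + ?b2)")
proof -
  note [measurable] = meas
  have [measurable]: "W \<in> borel_measurable M"
    unfolding W_def by measurable
  have finB: "finite (B a)" if "a \<in> A" for a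
    using B[OF that] A finite_subset by blast
  define I where "I a \<omega> = (of_bool (Q a \<omega>) :: real)" for a \<omega>
  have [measurable]: "I a \<in> borel_measurable M" if "a \<in> A" for a
    unfolding I_def using that by measurable
  have I01: "0 \<le> I a \<omega>" "I a \<omega> \<le> 1" for a \<omega> by (auto simp: I_def)
  have intI: "integrable M (I a)" if "a \<in> A" for a
    using that I01 by (intro integrable_const_bound[where B = 1]) auto
  have intII: "integrable M (\<lambda>\<omega>. I a \<omega> * I b \<omega>)" if "a \<in> A" "b \<in> A" for a b
    using that I01 by (intro integrable_const_bound[where B = 1]) (auto simp: mult_le_one)
  have EI: "expectation (I a) = p a" if "a \<in> A" for a
  proof -
    have "expectation (I a) = expectation (indicator {\<omega>\<in>space M. Q a \<omega>})"
      by (intro Bochner_Integration.integral_cong) (auto simp: I_def indicator_def)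
    with that show ?thesis by (simp add: p_def)
  qed
  have EII: "expectation (\<lambda>\<omega>. I a \<omega> * I b \<omega>) = prob {\<omega>\<in>space M. Q a \<omega> \<and> Q b \<omega>}"
    if "a \<in> A" "b \<in> A" for a b
  proof -
    have "expectation (\<lambda>\<omega>. I a \<omega> * I b \<omega>) = expectation (indicator {\<omega>\<in>space M. Q a \<omega> \<and> Q b \<omega>})"
      by (intro Bochner_Integration.integral_cong) (auto simp: I_def indicator_def)
    with that show ?thesis by simp
  qed
  (* W = I a + Z a + R a, where R a is independent of I a, and replacing R a by W costs E (I a + Z a). *)
  define Z where "Z a \<omega> = (\<Sum>b\<in>B a - {a}. I b \<omega>)" for a \<omega>
  define R where "R a \<omega> = (\<Sum>b\<in>A - B a. I b \<omega>)" for a \<omega>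
  have Z0: "0 \<le> Z a \<omega>" for a \<omega> unfolding Z_def by (intro sum_nonneg I01)
  have [measurable]: "Z a \<in> borel_measurable M" "R a \<in> borel_measurable M" if "a \<in> A" for a
    unfolding Z_def R_def using B[OF that] by (auto intro!: borel_measurable_sum)
  have W_split: "W \<omega> = I a \<omega> + Z a \<omega> + R a \<omega>" if "a \<in> A" for a \<omega>
  proof -
    have "W \<omega> = (\<Sum>b\<in>B a. I b \<omega>) + R a \<omega>"
      unfolding W_def R_def I_def using B[OF that] A by (metis sum.subset_diff add.commute)
    also have "(\<Sum>b\<in>B a. I b \<omega>) = I a \<omega> + Z a \<omega>"
      unfolding Z_def using B[OF that] finB[OF that] by (intro sum.remove) auto
    finally show ?thesis .
  qed
  \<comment> \<open>Two replacements: under the indicator \<open>I a\<close>, W becomes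
    \<open>1 + R a\<close>, at the price of the b2 terms; after factorization by independence,
    \<open>R a\<close> becomes W again, at the price of the b1 terms.\<close>
  have step: "cmod ((\<integral>\<omega>. I a \<omega> * iexp (s * W \<omega>) \<partial>M) - iexp s * (p a * (\<integral>\<omega>. iexp (s * W \<omega>) \<partial>M)))
      \<le> \<bar>s\<bar> * ((\<Sum>b\<in>B a. p a * p b) + (\<Sum>b\<in>B a - {a}. prob {\<omega>\<in>space M. Q a \<omega> \<and> Q b \<omega>}))"
    if a: "a \<in> A" for a s
  proof -
    have intE: "integrable M (\<lambda>\<omega>. iexp (s * f \<omega>))" if [measurable]: "f \<in> borel_measurable M" for f
      by (intro integrable_const_bound[where B = 1]) auto
    have intIE: "integrable M (\<lambda>\<omega>. complex_of_real (I a \<omega>) * iexp (s * f \<omega>))"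
      if [measurable]: "f \<in> borel_measurable M" for f
      using a I01 by (intro integrable_const_bound[where B = 1]) (auto simp: norm_mult)
    have "indep_var borel (complex_of_real \<circ> (\<lambda>\<omega>. I a \<omega>)) borel ((\<lambda>x. iexp (s * x)) \<circ> (\<lambda>\<omega>. R a \<omega>))"
      using indep[OF a] unfolding I_def R_def by (rule indep_var_compose) auto
    then have ind: "(\<integral>\<omega>. I a \<omega> * iexp (s * R a \<omega>) \<partial>M) = p a * (\<integral>\<omega>. iexp (s * R a \<omega>) \<partial>M)"
      using a intI[OF a] intE[of "R a"] EI[OF a]
      by (subst indep_var_lebesgue_integral) (auto simp: o_def)
    have intZ: "integrable M (Z a)"
      unfolding Z_def using B[OF a] by (intro Bochner_Integration.integrable_sum intI) auto
    have intIZ: "integrable M (\<lambda>\<omega>. I a \<omega> * Z a \<omega>)"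
      unfolding Z_def sum_distrib_left using B[OF a] a
      by (intro Bochner_Integration.integrable_sum intII) auto
    have "cmod ((\<integral>\<omega>. I a \<omega> * iexp (s * W \<omega>) \<partial>M) - iexp s * (\<integral>\<omega>. I a \<omega> * iexp (s * R a \<omega>) \<partial>M))
        = cmod (\<integral>\<omega>. I a \<omega> * iexp (s * W \<omega>) - iexp s * (I a \<omega> * iexp (s * R a \<omega>)) \<partial>M)"
      using a intIE[of W] intIE[of "R a"] by simp
    also have "\<dots> \<le> (\<integral>\<omega>. \<bar>s\<bar> * (I a \<omega> * Z a \<omega>) \<partial>M)"
    proof (rule norm_integral_le_integral)
      fix \<omega>
      show "cmod (I a \<omega> * iexp (s * W \<omega>) - iexp s * (I a \<omega> * iexp (s * R a \<omega>))) \<le> \<bar>s\<bar> * (I a \<omega> * Z a \<omega>)"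
      proof (cases "Q a \<omega>")
        case True
        \<comment> \<open>When \<open>Q a\<close> holds, W equals \<open>1 + Z a + R a\<close>, so
          the two phases differ by \<open>s * Z a\<close> only. When it fails, both terms
          vanish.\<close>
        have "I a \<omega> * iexp (s * W \<omega>) - iexp s * (I a \<omega> * iexp (s * R a \<omega>))
            = iexp (s * W \<omega>) - iexp (s + s * R a \<omega>)"
          using True by (simp add: I_def ring_distribs exp_add)
        also have "cmod \<dots> \<le> \<bar>s * W \<omega> - (s + s * R a \<omega>)\<bar>" by (rule norm_iexp_diff_le)
        also have "\<dots> = \<bar>s\<bar> * Z a \<omega>"
          using W_split[OF a, of \<omega>] True Z0[of a \<omega>] by (simp add: I_def algebra_simps abs_mult)
        finally show ?thesis using True by (simp add: I_def)
      qed (simp add: I_def)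
    qed (use intIZ a intIE[of W] intIE[of "R a"] in auto)
    also have "\<dots> = \<bar>s\<bar> * (\<Sum>b\<in>B a - {a}. expectation (\<lambda>\<omega>. I a \<omega> * I b \<omega>))"
      unfolding Z_def sum_distrib_left using B[OF a] a intII[OF a]
      by (subst Bochner_Integration.integral_sum) (auto simp: mult.assoc)
    also have "(\<Sum>b\<in>B a - {a}. expectation (\<lambda>\<omega>. I a \<omega> * I b \<omega>))
        = (\<Sum>b\<in>B a - {a}. prob {\<omega>\<in>space M. Q a \<omega> \<and> Q b \<omega>})"
      using B[OF a] a by (intro sum.cong refl EII) auto
    finally have 1: "cmod ((\<integral>\<omega>. I a \<omega> * iexp (s * W \<omega>) \<partial>M) - iexp s * (p a * (\<integral>\<omega>. iexp (s * R a \<omega>) \<partial>M)))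
        \<le> \<bar>s\<bar> * (\<Sum>b\<in>B a - {a}. prob {\<omega>\<in>space M. Q a \<omega> \<and> Q b \<omega>})"
      unfolding ind .
    have "cmod ((\<integral>\<omega>. iexp (s * R a \<omega>) \<partial>M) - (\<integral>\<omega>. iexp (s * W \<omega>) \<partial>M))
        = cmod (\<integral>\<omega>. iexp (s * R a \<omega>) - iexp (s * W \<omega>) \<partial>M)"
      using a intE[of W] intE[of "R a"] by simp
    also have "\<dots> \<le> (\<integral>\<omega>. \<bar>s\<bar> * (I a \<omega> + Z a \<omega>) \<partial>M)"
    proof (rule norm_integral_le_integral)
      fix \<omega>
      have "cmod (iexp (s * R a \<omega>) - iexp (s * W \<omega>)) \<le> \<bar>s * R a \<omega> - s * W \<omega>\<bar>"
        by (rule norm_iexp_diff_le)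
      also have "\<dots> = \<bar>s\<bar> * \<bar>R a \<omega> - W \<omega>\<bar>"
        by (simp flip: abs_mult right_diff_distrib)
      also have "\<bar>R a \<omega> - W \<omega>\<bar> = I a \<omega> + Z a \<omega>"
        using W_split[OF a, of \<omega>] Z0[of a \<omega>] I01[of a \<omega>] by simp
      finally show "cmod (iexp (s * R a \<omega>) - iexp (s * W \<omega>)) \<le> \<bar>s\<bar> * (I a \<omega> + Z a \<omega>)" .
    qed (use intZ intI a intE[of W] intE[of "R a"] in auto)
    also have "\<dots> = \<bar>s\<bar> * (p a + (\<Sum>b\<in>B a - {a}. p b))"
    proof -
      have "expectation (Z a) = (\<Sum>b\<in>B a - {a}. p b)"
        unfolding Z_def using B[OF a] intI EI
        by (subst Bochner_Integration.integral_sum) (auto intro!: sum.cong)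
      with intZ intI EI a show ?thesis by simp
    qed
    also have "p a + (\<Sum>b\<in>B a - {a}. p b) = (\<Sum>b\<in>B a. p b)"
      using B[OF a] finB[OF a] by (intro sum.remove[symmetric]) auto
    finally have 2: "cmod ((\<integral>\<omega>. iexp (s * R a \<omega>) \<partial>M) - (\<integral>\<omega>. iexp (s * W \<omega>) \<partial>M)) \<le> \<bar>s\<bar> * (\<Sum>b\<in>B a. p b)" .
    have p0: "p a \<ge> 0" by (simp add: p_def)
    have "cmod (iexp s * (p a * (\<integral>\<omega>. iexp (s * R a \<omega>) \<partial>M)) - iexp s * (p a * (\<integral>\<omega>. iexp (s * W \<omega>) \<partial>M)))
        = p a * cmod ((\<integral>\<omega>. iexp (s * R a \<omega>) \<partial>M) - (\<integral>\<omega>. iexp (s * W \<omega>) \<partial>M))"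
      using p0 by (simp add: norm_mult flip: right_diff_distrib)
    also have "\<dots> \<le> p a * (\<bar>s\<bar> * (\<Sum>b\<in>B a. p b))"
      using 2 p0 by (rule mult_left_mono)
    also have "\<dots> = \<bar>s\<bar> * (\<Sum>b\<in>B a. p a * p b)"
      by (simp add: sum_distrib_left mult_ac)
    finally show ?thesis
      using 1 by (smt (verit) norm_triangle_sub distrib_left norm_diff_triangle_ineq norm_diff_triangle_le)
  qed
  \<comment> \<open>The natural-valued copy of W, bounded by \<open>card A\<close>, makes the
    differentiation lemma applicable.\<close>
  define N where "N \<omega> = (\<Sum>a\<in>A. of_bool (Q a \<omega>) :: nat)" for \<omega>
  have NW: "real (N \<omega>) = W \<omega>" for \<omega> by (simp add: N_def W_def)
  have [measurable]: "N \<in> measurable M (count_space UNIV)"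
    unfolding N_def by measurable
  have "N \<omega> \<le> card A" for \<omega>
    unfolding N_def using sum_bounded_above[of A "\<lambda>a. of_bool (Q a \<omega>)" "1::nat"] by auto
  then have deriv: "((\<lambda>s. \<integral>\<omega>. iexp (s * W \<omega>) \<partial>M) has_vector_derivative
        (\<integral>\<omega>. \<i> * of_real (W \<omega>) * iexp (s * W \<omega>) \<partial>M)) (at s)" for s
    using has_vector_derivative_char_nat[of N "card A" s] by (simp flip: NW)
  have bound: "cmod ((\<integral>\<omega>. \<i> * of_real (W \<omega>) * iexp (s * W \<omega>) \<partial>M)
        - \<i> * of_real (\<Sum>a\<in>A. p a) * iexp s * (\<integral>\<omega>. iexp (s * W \<omega>) \<partial>M)) \<le> \<bar>s\<bar> * (?b1 + ?b2)" for s
  proof -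
    have int: "integrable M (\<lambda>\<omega>. complex_of_real (I a \<omega>) * iexp (s * W \<omega>))" if "a \<in> A" for a
      using that I01 by (intro integrable_const_bound[where B = 1]) (auto simp: norm_mult)
    have "(\<integral>\<omega>. \<i> * of_real (W \<omega>) * iexp (s * W \<omega>) \<partial>M)
        = (\<integral>\<omega>. \<i> * (\<Sum>a\<in>A. I a \<omega> * iexp (s * W \<omega>)) \<partial>M)"
      by (simp add: W_def I_def sum_distrib_right sum_distrib_left mult.assoc)
    also have "\<dots> = \<i> * (\<Sum>a\<in>A. \<integral>\<omega>. I a \<omega> * iexp (s * W \<omega>) \<partial>M)"
      using int by (simp add: Bochner_Integration.integral_sum)
    finally have "(\<integral>\<omega>. \<i> * of_real (W \<omega>) * iexp (s * W \<omega>) \<partial>M)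
        - \<i> * of_real (\<Sum>a\<in>A. p a) * iexp s * (\<integral>\<omega>. iexp (s * W \<omega>) \<partial>M)
        = \<i> * (\<Sum>a\<in>A. (\<integral>\<omega>. I a \<omega> * iexp (s * W \<omega>) \<partial>M)
            - iexp s * (p a * (\<integral>\<omega>. iexp (s * W \<omega>) \<partial>M)))"
      by (simp add: sum_subtractf right_diff_distrib sum_distrib_left sum_distrib_right mult_ac)
    also have "cmod \<dots> \<le> (\<Sum>a\<in>A. \<bar>s\<bar> * ((\<Sum>b\<in>B a. p a * p b)
        + (\<Sum>b\<in>B a - {a}. prob {\<omega>\<in>space M. Q a \<omega> \<and> Q b \<omega>})))"
      unfolding norm_mult norm_ii mult_1 by (intro sum_norm_le step)
    also have "\<dots> = \<bar>s\<bar> * (?b1 + ?b2)"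
      by (simp only: sum_distrib_left[symmetric] sum.distrib)
    finally show ?thesis .
  qed
  have char: "char (distr M borel W) s = (\<integral>\<omega>. iexp (s * W \<omega>) \<partial>M)" for s
    unfolding char_def by (subst integral_distr) auto
  show ?thesis
    unfolding char
    by (rule norm_diff_poisson_char_le[OF deriv _ _ _ bound])
      (auto simp: prob_space p_def intro!: sum_nonneg add_nonneg_nonneg mult_nonneg_nonneg)
qed

end

section \<open>Sets of balls that share a box\<close>

lemma box_prob_moment_nonneg: "0 \<le> box_prob_moment P X s"
  unfolding box_prob_moment_def by (intro integral_nonneg_AE) (simp add: box_prob_def)

text \<open>Naming the common label, rather than asking for pairwise equality, exhibits the event as
  a countable union over labels. This serves both measurability and the computation of its
  probability. The empty set satisfies it trivially.\<close>

definition same_box :: "(nat \<Rightarrow> 'a \<Rightarrow> nat) \<Rightarrow> nat set \<Rightarrow> 'a \<Rightarrow> bool" where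
  "same_box X S \<omega> \<longleftrightarrow> (\<exists>m. \<forall>j\<in>S. X j \<omega> = m)"

definition balls :: "nat \<Rightarrow> nat \<Rightarrow> nat set set" where
  "balls n k = {S. S \<subseteq> {1..n} \<and> card S = k}"

lemma finite_balls [simp]: "finite (balls n k)"
  unfolding balls_def by (rule finite_subset[of _ "Pow {1..n}"]) auto

lemma card_balls: "card (balls n k) = n choose k"
  unfolding balls_def by (subst n_subsets) auto

text \<open>A ball in both sets forces the two labels to agree. Joint probabilities of overlapping
  sets thus reduce to the probability for a single set.\<close>

lemma same_box_Un:
  assumes "S \<inter> T \<noteq> {}"
  shows "same_box X S \<omega> \<and> same_box X T \<omega> \<longleftrightarrow> same_box X (S \<union> T) \<omega>"
proof -
  obtain x where x: "x \<in> S" "x \<in> T" using assms by blast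
  have "same_box X U \<omega> \<longleftrightarrow> (\<forall>j\<in>U. X j \<omega> = X x \<omega>)" if "x \<in> U" for U
    using that unfolding same_box_def by metis
  then show ?thesis using x by auto
qed

text \<open>Bounds both Chen-Stein sums: \<open>f\<close> is constant for the products of
  probabilities and a moment for the joint ones. The factor \<open>4 ^ t\<close> is crude, but it
  does not depend on \<open>n\<close>.\<close>

lemma sum_pairs_le:
  fixes f :: "nat \<Rightarrow> real"
  assumes D: "D \<subseteq> balls n k \<times> balls n k"
    and K: "finite K" "\<And>S T. (S, T) \<in> D \<Longrightarrow> card (S \<union> T) \<in> K"
    and f: "\<And>t. f t \<ge> 0"
  shows "(\<Sum>(S, T)\<in>D. f (card (S \<union> T))) \<le> (\<Sum>t\<in>K. 4 ^ t * real (n choose t) * f t)"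
proof -
  (* Grouping by U = S Un T: at most 4^(card U) pairs have the same union. *)
  define \<U> where "\<U> = {U. U \<subseteq> {1..n} \<and> card U \<in> K}"
  have fin: "finite \<U>" unfolding \<U>_def by (rule finite_subset[of _ "Pow {1..n}"]) auto
  have finD: "finite D" using D by (rule finite_subset) simp
  have D\<U>: "fst x \<union> snd x \<in> \<U>" if "x \<in> D" for x
  proof -
    have "x \<in> balls n k \<times> balls n k" "card (fst x \<union> snd x) \<in> K"
      using that D K(2)[of "fst x" "snd x"] by auto
    then show ?thesis unfolding \<U>_def balls_def by auto
  qed
  have "(\<Sum>(S, T)\<in>D. f (card (S \<union> T)))
      = (\<Sum>U\<in>\<U>. \<Sum>x\<in>{x\<in>D. fst x \<union> snd x = U}. f (card (fst x \<union> snd x)))"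
    unfolding case_prod_beta using D\<U> finD fin
    by (intro sum.group[symmetric]) auto
  also have "\<dots> \<le> (\<Sum>U\<in>\<U>. 4 ^ card U * f (card U))"
  proof (rule sum_mono)
    fix U assume "U \<in> \<U>"
    then have U: "finite U" by (auto simp: \<U>_def intro: finite_subset)
    have "card {x\<in>D. fst x \<union> snd x = U} \<le> card (Pow U \<times> Pow U)"
      using U by (intro card_mono) auto
    also have "\<dots> = (2 * 2) ^ card U"
      using U by (simp add: card_cartesian_product card_Pow flip: power_mult_distrib)
    finally have "real (card {x\<in>D. fst x \<union> snd x = U}) \<le> 4 ^ card U"
      by (simp flip: of_nat_le_iff)
    then show "(\<Sum>x\<in>{x\<in>D. fst x \<union> snd x = U}. f (card (fst x \<union> snd x))) \<le> 4 ^ card U * f (card U)"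
      using f by (simp add: mult_right_mono)
  qed
  also have "\<dots> = (\<Sum>t\<in>K. \<Sum>U\<in>{U\<in>\<U>. card U = t}. 4 ^ card U * f (card U))"
    using fin K by (intro sum.group[symmetric]) (auto simp: \<U>_def)
  also have "\<dots> = (\<Sum>t\<in>K. 4 ^ t * real (n choose t) * f t)"
  proof (rule sum.cong[OF refl])
    fix t assume "t \<in> K"
    then have "{U\<in>\<U>. card U = t} = balls n t" by (auto simp: \<U>_def balls_def)
    then have "(\<Sum>U\<in>{U\<in>\<U>. card U = t}. 4 ^ card U * f (card U)) = (\<Sum>U\<in>balls n t. 4 ^ t * f t)"
      by (intro sum.cong) (auto simp: balls_def)
    then show "(\<Sum>U\<in>{U\<in>\<U>. card U = t}. 4 ^ card U * f (card U)) = 4 ^ t * real (n choose t) * f t"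
      by (simp add: card_balls)
  qed
  finally show ?thesis .
qed

section \<open>The overflow outcome by outcome\<close>

context ball_allocation begin

text \<open>Only the label of ball \<open>k\<close> contributes to the infinite sum, and that label
  lies in \<open>M\<close> because \<open>\<omega>\<close> is in the space.\<close>

lemma overflows_eq:
  assumes "k \<in> {1..n}" "\<omega> \<in> space P"
  shows "overflows M X r k \<omega> = of_bool (load_before X k (X k \<omega>) \<omega> \<ge> r)"
proof -
  have "overflows M X r k \<omega> =
      (\<Sum>\<^sub>\<infinity>m\<in>{X k \<omega>}. of_bool (X k \<omega> = m) * of_bool (load_before X k m \<omega> \<ge> r))"
    unfolding overflows_def using values_in[OF assms] by (intro infsum_cong_neutral) auto
  then show ?thesis by simp
qed

lemma overflow_eq_card:
  assumes "\<omega> \<in> space P"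
  shows "overflow M X n r \<omega> = card {k\<in>{1..n}. load_before X k (X k \<omega>) \<omega> \<ge> r}"
proof -
  have "overflow M X n r \<omega> = (\<Sum>k=1..n. of_bool (load_before X k (X k \<omega>) \<omega> \<ge> r))"
    unfolding overflow_def using overflows_eq assms by (intro sum.cong) auto
  then show ?thesis by (simp add: Int_def)
qed

text \<open>A box with q balls in the end contributes \<open>q - r\<close> overflows (truncated
  subtraction) and \<open>q choose (r + 1)\<close> sets. Both are 0 for q at most \<open>r\<close>
  and 1 for q = \<open>r + 1\<close>, and \<open>few\<close> excludes larger q.\<close>

lemma overflow_eq_card_same_box:
  assumes \<omega>: "\<omega> \<in> space P" and few: "\<And>S. S \<in> balls n (r + 2) \<Longrightarrow> \<not> same_box X S \<omega>"
  shows "overflow M X n r \<omega> = card {S\<in>balls n (r + 1). same_box X S \<omega>}"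
proof -
  (* A ball k that overflows corresponds to the set f k of balls up to k in its box, and k = Max (f k). *)
  define f where "f k = {j\<in>{1..k}. X j \<omega> = X k \<omega>}" for k
  have few': "card S \<le> r + 1" if "S \<subseteq> {1..n}" "same_box X S \<omega>" for S
  proof (rule ccontr)
    assume "\<not> card S \<le> r + 1"
    then obtain T where "T \<subseteq> S" "card T = r + 2"
      by (metis obtain_subset_with_card_n Suc_eq_plus1 add_2_eq_Suc' not_less_eq_eq)
    then show False using few[of T] that by (auto simp: balls_def same_box_def)
  qed
  \<comment> \<open>The extra 1 is ball \<open>k\<close> itself, which \<open>load_before\<close>
    does not count; so ball \<open>k\<close> overflows exactly when \<open>f k\<close> has at least
    \<open>r + 1\<close> elements.\<close>
  have load: "card (f k) = load_before X k (X k \<omega>) \<omega> + 1" if "k \<ge> 1" for k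
  proof -
    have "f k = insert k {j\<in>{1..<k}. X j \<omega> = X k \<omega>}"
      using that unfolding f_def by (auto simp: le_less)
    then show ?thesis by (simp add: load_before_def Int_def)
  qed
  have Max_f: "Max (f k) = k" if "k \<ge> 1" for k
    using that unfolding f_def by (intro Max_eqI) auto
  have fs: "f k \<subseteq> {1..n}" "same_box X (f k) \<omega>" if "k \<le> n" for k
    using that by (auto simp: f_def same_box_def)
  have "bij_betw f {k\<in>{1..n}. load_before X k (X k \<omega>) \<omega> \<ge> r} {S\<in>balls n (r + 1). same_box X S \<omega>}"
  proof (rule bij_betwI[where g = Max])
    show "f \<in> {k\<in>{1..n}. load_before X k (X k \<omega>) \<omega> \<ge> r} \<rightarrow> {S\<in>balls n (r + 1). same_box X S \<omega>}"
    proof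
      fix k assume "k \<in> {k\<in>{1..n}. load_before X k (X k \<omega>) \<omega> \<ge> r}"
      then have "k \<le> n" "card (f k) \<ge> r + 1" using load[of k] by auto
      then show "f k \<in> {S\<in>balls n (r + 1). same_box X S \<omega>}"
        using few'[of "f k"] fs[of k] by (simp add: balls_def)
    qed
    have main: "Max S \<in> S \<and> f (Max S) = S" if "S \<in> balls n (r + 1)" "same_box X S \<omega>" for S
    proof -
      from that have S: "finite S" "S \<noteq> {}" "S \<subseteq> {1..n}" "card S = r + 1"
        by (auto simp: balls_def intro: finite_subset)
      then have Max: "Max S \<in> S" by simp
      have "S \<subseteq> f (Max S)"
      proof
        fix j assume j: "j \<in> S"
        have "X j \<omega> = X (Max S) \<omega>"
          using that(2) Max j unfolding same_box_def by metis
        then show "j \<in> f (Max S)"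
          using j S by (auto simp: f_def)
      qed
      \<comment> \<open>The inclusion is already known and \<open>S\<close> has \<open>r + 1\<close>
        elements, so this upper bound forces equality.\<close>
      moreover have "card (f (Max S)) \<le> r + 1"
        using S Max by (intro few' fs) auto
      ultimately have "S = f (Max S)"
        using S(4) by (intro card_seteq) (auto simp: f_def)
      with Max show ?thesis by simp
    qed
    show "Max \<in> {S\<in>balls n (r + 1). same_box X S \<omega>} \<rightarrow> {k\<in>{1..n}. load_before X k (X k \<omega>) \<omega> \<ge> r}"
    proof
      fix S assume S: "S \<in> {S\<in>balls n (r + 1). same_box X S \<omega>}"
      then have "Max S \<in> {1..n}" "card (f (Max S)) = r + 1"
        using main[of S] by (auto simp: balls_def)
      then show "Max S \<in> {k\<in>{1..n}. load_before X k (X k \<omega>) \<omega> \<ge> r}"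
        using load[of "Max S"] by auto
    qed
    show "Max (f k) = k" if "k \<in> {k\<in>{1..n}. load_before X k (X k \<omega>) \<omega> \<ge> r}" for k
      using that by (intro Max_f) auto
    show "f (Max S) = S" if "S \<in> {S\<in>balls n (r + 1). same_box X S \<omega>}" for S
      using that main by auto
  qed
  then show ?thesis
    unfolding overflow_eq_card[OF \<omega>] by (rule bij_betw_same_card)
qed

section \<open>Measurability and independence\<close>

lemma measurable_box [measurable]: "j \<in> {1..n} \<Longrightarrow> X j \<in> measurable P (count_space UNIV)"
  using indep unfolding indep_vars_def by auto

lemma measurable_same_box [measurable]:
  "S \<subseteq> {1..n} \<Longrightarrow> Measurable.pred P (same_box X S)"
  unfolding same_box_def[abs_def]
  by (intro pred_intros_countable pred_intros_finite) (auto intro: finite_subset)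

lemma measurable_overflow [measurable]: "overflow M X n r \<in> measurable P (count_space UNIV)"
proof -
  have "(\<lambda>\<omega>. \<Sum>k=1..n. of_bool (load_before X k (X k \<omega>) \<omega> \<ge> r) :: nat) \<in> measurable P (count_space UNIV)"
    unfolding load_before_def by measurable
  then show ?thesis
    by (rule measurable_cong[THEN iffD1, rotated])
      (auto simp: overflow_def overflows_eq intro!: sum.cong)
qed

text \<open>The two variables are functions of disjoint blocks of balls, \<open>S\<close> and its
  complement in \<open>{1..n}\<close>. A whole family \<open>\<T>\<close> is treated at once because
  decoupling needs independence from the entire sum, not just from each summand.\<close>

lemma indep_same_box:
  assumes S: "S \<subseteq> {1..n}" and B: "finite \<T>" "\<And>T. T \<in> \<T> \<Longrightarrow> T \<subseteq> {1..n} - S"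
  shows "indep_var borel (\<lambda>\<omega>. of_bool (same_box X S \<omega>) :: real)
    borel (\<lambda>\<omega>. \<Sum>T\<in>\<T>. of_bool (same_box X T \<omega>) :: real)"
proof -
  have *: "(\<lambda>x. of_bool (\<exists>m. \<forall>j\<in>T. x j = m) :: real)
      \<in> borel_measurable (\<Pi>\<^sub>M j\<in>A. count_space (UNIV :: nat set))" if "T \<subseteq> A" "A \<subseteq> {1..n}" for T A
    by (measurable; use that in \<open>auto intro: finite_subset\<close>)
  have "indep_var borel ((\<lambda>x. of_bool (\<exists>m. \<forall>j\<in>S. x j = m) :: real) \<circ> (\<lambda>\<omega>. restrict (\<lambda>j. X j \<omega>) S))
      borel ((\<lambda>x. \<Sum>T\<in>\<T>. of_bool (\<exists>m. \<forall>j\<in>T. x j = m) :: real) \<circ> (\<lambda>\<omega>. restrict (\<lambda>j. X j \<omega>) ({1..n} - S)))"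
    using S B
    by (intro indep_var_compose[OF indep_var_restrict[OF indep]] borel_measurable_sum *) auto
  also have "(\<lambda>x. of_bool (\<exists>m. \<forall>j\<in>S. x j = m) :: real) \<circ> (\<lambda>\<omega>. restrict (\<lambda>j. X j \<omega>) S)
      = (\<lambda>\<omega>. of_bool (same_box X S \<omega>))"
    by (simp add: same_box_def fun_eq_iff)
  also have "(\<lambda>x. \<Sum>T\<in>\<T>. of_bool (\<exists>m. \<forall>j\<in>T. x j = m) :: real) \<circ> (\<lambda>\<omega>. restrict (\<lambda>j. X j \<omega>) ({1..n} - S))
      = (\<lambda>\<omega>. \<Sum>T\<in>\<T>. of_bool (same_box X T \<omega>))"
  proof -
    have "(\<exists>m. \<forall>j\<in>T. restrict (\<lambda>j. X j \<omega>) ({1..n} - S) j = m) = same_box X T \<omega>" if "T \<in> \<T>" for T \<omega>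
      using B(2)[OF that] unfolding same_box_def by (auto simp: subset_iff)
    then show ?thesis by (auto simp: fun_eq_iff simp del: sum_of_bool_eq intro!: sum.cong)
  qed
  finally show ?thesis .
qed

section \<open>Probabilities in terms of moments of the box law\<close>

text \<open>The law is discrete with weights \<open>box_prob P X m\<close>; the weight supplies the
  additional power in \<open>Suc s\<close>.\<close>

lemma box_prob_moment_sums:
  assumes "n \<ge> 1"
  shows "(\<lambda>m. box_prob P X m ^ Suc s) sums box_prob_moment P X s"
proof -
  have X1[measurable]: "X 1 \<in> measurable P (count_space UNIV)"
    using assms by (intro measurable_box) auto
  have law: "box_law P X = density (count_space UNIV) (\<lambda>m. ennreal (box_prob P X m))"
  proof (rule measure_eqI_countable[where A = UNIV])
    fix m
    have "emeasure (box_law P X) {m} = emeasure P {\<omega>\<in>space P. X 1 \<omega> = m}"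
      unfolding box_law_def by (subst emeasure_distr[OF X1]) (auto intro!: arg_cong[of _ _ "emeasure P"])
    then show "emeasure (box_law P X) {m} = emeasure (density (count_space UNIV) (\<lambda>m. ennreal (box_prob P X m))) {m}"
      by (simp add: emeasure_density box_prob_def emeasure_eq_measure)
  qed (auto simp: box_law_def)
  interpret law: prob_space "box_law P X"
    unfolding box_law_def by (rule prob_space_distr) fact
  have "integrable (box_law P X) (\<lambda>m. box_prob P X m ^ s)"
    by (intro law.integrable_const_bound[where B = 1])
      (auto simp: box_law_def box_prob_def power_le_one)
  then have "integrable (count_space UNIV) (\<lambda>m. box_prob P X m ^ Suc s)"
    unfolding law by (subst (asm) integrable_density) (auto simp: box_prob_def)
  from sums_integral_count_space_nat[OF this] show ?thesis
    unfolding box_prob_moment_def law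
    by (subst integral_density) (auto simp: box_prob_def)
qed

lemma box_prob_eq:
  assumes "j \<in> {1..n}"
  shows "prob {\<omega>\<in>space P. X j \<omega> = m} = box_prob P X m"
proof -
  have "measure (distr P (count_space UNIV) (X i)) {m} = prob {\<omega>\<in>space P. X i \<omega> = m}" if "i \<in> {1..n}" for i
    using that by (subst measure_distr) (auto intro!: arg_cong[of _ _ prob])
  from this[of j] this[of 1] show ?thesis
    using identically_distributed[OF assms] assms by (simp add: box_prob_def)
qed

text \<open>Split by the common label: the events are disjoint since \<open>S\<close> is nonempty,
  and independence gives each the power \<open>card S\<close> of a box probability. One of these
  factors is the weight of the law, hence the index \<open>card S - 1\<close>.\<close>

lemma prob_same_box:
  assumes S: "S \<subseteq> {1..n}" "S \<noteq> {}"
  shows "prob {\<omega>\<in>space P. same_box X S \<omega>} = box_prob_moment P X (card S - 1)"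
proof -
  have fin: "finite S" using S finite_subset by blast
  have n: "n \<ge> 1" using S by auto
  define E where "E m = {\<omega>\<in>space P. \<forall>j\<in>S. X j \<omega> = m}" for m
  have E: "E m \<in> events" for m
    unfolding E_def using fin by (measurable; use S in auto)
  have "prob (E m) = box_prob P X m ^ Suc (card S - 1)" for m
  proof -
    have "E m = (\<Inter>j\<in>S. X j -` {m} \<inter> space P)" using S by (auto simp: E_def)
    then have "prob (E m) = (\<Prod>j\<in>S. prob (X j -` {m} \<inter> space P))"
      using indep_varsD[OF indep, of S "\<lambda>_. {m}"] S fin by simp
    also have "\<dots> = (\<Prod>j\<in>S. box_prob P X m)"
    proof (rule prod.cong[OF refl])
      fix j assume "j \<in> S"
      moreover have "X j -` {m} \<inter> space P = {\<omega>\<in>space P. X j \<omega> = m}" by auto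
      ultimately show "prob (X j -` {m} \<inter> space P) = box_prob P X m"
        using S box_prob_eq by auto
    qed
    also have "\<dots> = box_prob P X m ^ Suc (card S - 1)"
      using S fin by (simp add: card_gt_0_iff)
    finally show ?thesis .
  qed
  moreover have "(\<lambda>m. prob (E m)) sums prob (\<Union>m. E m)"
    using E S by (intro finite_measure_UNION) (auto simp: disjoint_family_on_def E_def)
  moreover have "(\<Union>m. E m) = {\<omega>\<in>space P. same_box X S \<omega>}"
    by (auto simp: E_def same_box_def)
  ultimately have "(\<lambda>m. box_prob P X m ^ Suc (card S - 1)) sums prob {\<omega>\<in>space P. same_box X S \<omega>}"
    by simp
  then show ?thesis
    using box_prob_moment_sums[OF n] by (rule sums_unique2)
qed

lemma box_prob_le_max:
  assumes "n \<ge> 1"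
  shows "box_prob P X m \<le> max_box_prob P M X"
proof -
  have le: "box_prob P X m \<le> max_box_prob P M X" if "m \<in> M" for m
    unfolding max_box_prob_def using that
    by (intro cSUP_upper bdd_aboveI[of _ 1]) (auto simp: box_prob_def)
  show ?thesis
  proof (cases "m \<in> M")
    case False
    \<comment> \<open>Some outcome exists, so \<open>M\<close> contains a label and the supremum is
      nonnegative. That suffices for labels outside \<open>M\<close>, whose probability is
      0.\<close>
    obtain \<omega> where "\<omega> \<in> space P" using not_empty by blast
    then have "X 1 \<omega> \<in> M" using assms by (intro values_in) auto
    from le[OF this] have "0 \<le> max_box_prob P M X"
      by (rule order_trans[rotated]) (simp add: box_prob_def)
    moreover have empty: "{\<omega>\<in>space P. X 1 \<omega> = m} = {}" using False values_in[of 1] assms by auto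
    ultimately show ?thesis unfolding box_prob_def empty by simp
  qed (rule le)
qed

text \<open>In each term of the series, \<open>d\<close> of the factors are bounded by the largest
  box probability. Through this inequality the hypothesis \<open>small\<close> takes effect.\<close>

lemma box_prob_moment_le:
  assumes n: "n \<ge> 1"
  shows "box_prob_moment P X (s + d) \<le> max_box_prob P M X ^ d * box_prob_moment P X s"
proof (rule sums_le[OF _ box_prob_moment_sums[OF n] sums_mult[OF box_prob_moment_sums[OF n]]])
  fix m
  have p: "0 \<le> box_prob P X m" by (simp add: box_prob_def)
  have "box_prob P X m ^ d * box_prob P X m ^ Suc s \<le> max_box_prob P M X ^ d * box_prob P X m ^ Suc s"
    using p box_prob_le_max[OF n] by (intro mult_right_mono power_mono) auto
  then show "box_prob P X m ^ Suc (s + d) \<le> max_box_prob P M X ^ d * box_prob P X m ^ Suc s"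
    by (simp add: power_add mult_ac)
qed

section \<open>Error bounds for a fixed number of balls\<close>

text \<open>The neighbourhood of \<open>S\<close> consists of the \<open>k\<close>-sets that meet
  it. Sharing a ball keeps the union below \<open>2 * k\<close> elements, and distinct sets have a
  union of more than \<open>k\<close>; these are the two summation ranges for
  \<open>u\<close>.\<close>

lemma char_same_box_count_bound:
  fixes k :: nat
  assumes k: "k \<ge> 1"
  defines "l \<equiv> real (n choose k) * box_prob_moment P X (k - 1)"
  shows "cmod (char (distr P borel (\<lambda>\<omega>. \<Sum>S\<in>balls n k. of_bool (same_box X S \<omega>))) t
      - exp (of_real l * (iexp t - 1)))
    \<le> exp (2 * l) * t\<^sup>2 *
      ((\<Sum>u\<in>{k..<2 * k}. 4 ^ u * real (n choose u) * (box_prob_moment P X (k - 1))\<^sup>2)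
       + (\<Sum>u\<in>{k<..<2 * k}. 4 ^ u * real (n choose u) * box_prob_moment P X (u - 1)))"
proof -
  define B where "B S = {T\<in>balls n k. T \<inter> S \<noteq> {}}" for S
  have sub: "S \<subseteq> {1..n}" "S \<noteq> {}" "finite S" "card S = k" if "S \<in> balls n k" for S
    using that k by (auto simp: balls_def intro: finite_subset)
  have p: "prob {\<omega>\<in>space P. same_box X S \<omega>} = box_prob_moment P X (k - 1)" if "S \<in> balls n k" for S
    using prob_same_box[of S] sub[OF that] by simp
  have card_Un: "card (S \<union> T) \<in> {k..<2 * k}" if "S \<in> balls n k" "T \<in> B S" for S T
  proof -
    have T: "T \<in> balls n k" "card (S \<inter> T) \<ge> 1"
      using that sub[OF that(1)] by (auto simp: B_def Suc_le_eq card_gt_0_iff)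
    have "card S + card T = card (S \<union> T) + card (S \<inter> T)"
      using sub[OF that(1)] sub[OF T(1)] by (intro card_Un_Int) auto
    moreover have "card S \<le> card (S \<union> T)"
      using sub[OF that(1)] sub[OF T(1)] by (intro card_mono) auto
    ultimately show ?thesis
      using T(2) sub[OF that(1)] sub[OF T(1)] by auto
  qed
  have card_Un': "card (S \<union> T) \<in> {k<..<2 * k}" if "S \<in> balls n k" "T \<in> B S - {S}" for S T
  proof -
    have T: "T \<in> balls n k" using that by (auto simp: B_def)
    have "card (S \<union> T) \<noteq> k"
    proof
      assume *: "card (S \<union> T) = k"
      have "S = S \<union> T"
        by (rule card_seteq) (use * sub[OF that(1)] sub[OF T] in auto)
      moreover have "T = S \<union> T"
        by (rule card_seteq) (use * sub[OF that(1)] sub[OF T] in auto)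
      ultimately show False using that by auto
    qed
    then show ?thesis using card_Un[of S T] that by auto
  qed
  have BS: "finite (B S)" for S by (simp add: B_def)
  have "cmod (char (distr P borel (\<lambda>\<omega>. \<Sum>S\<in>balls n k. of_bool (same_box X S \<omega>))) t
      - exp (of_real (\<Sum>S\<in>balls n k. prob {\<omega>\<in>space P. same_box X S \<omega>}) * (iexp t - 1)))
    \<le> exp (2 * (\<Sum>S\<in>balls n k. prob {\<omega>\<in>space P. same_box X S \<omega>})) * t\<^sup>2 *
      ((\<Sum>S\<in>balls n k. \<Sum>T\<in>B S. prob {\<omega>\<in>space P. same_box X S \<omega>} * prob {\<omega>\<in>space P. same_box X T \<omega>})
       + (\<Sum>S\<in>balls n k. \<Sum>T\<in>B S - {S}. prob {\<omega>\<in>space P. same_box X S \<omega> \<and> same_box X T \<omega>}))"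
  proof (rule dependent_sum_char_bound)
    show "indep_var borel (\<lambda>\<omega>. of_bool (same_box X S \<omega>) :: real)
        borel (\<lambda>\<omega>. \<Sum>T\<in>balls n k - B S. of_bool (same_box X T \<omega>) :: real)" if "S \<in> balls n k" for S
      using that by (intro indep_same_box) (auto simp: B_def balls_def)
  qed (use sub in \<open>auto simp: B_def\<close>)
  also have "(\<Sum>S\<in>balls n k. prob {\<omega>\<in>space P. same_box X S \<omega>}) = l"
    using p by (simp add: card_balls l_def)
  also have "(\<Sum>S\<in>balls n k. \<Sum>T\<in>B S. prob {\<omega>\<in>space P. same_box X S \<omega>} * prob {\<omega>\<in>space P. same_box X T \<omega>})
      = (\<Sum>S\<in>balls n k. \<Sum>T\<in>B S. (box_prob_moment P X (k - 1))\<^sup>2)"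
    by (intro sum.cong refl) (auto simp: p B_def power2_eq_square)
  also have "\<dots> = (\<Sum>(S, T)\<in>Sigma (balls n k) B. (box_prob_moment P X (k - 1))\<^sup>2)"
    by (rule sum.Sigma) (auto simp: BS)
  also have "(\<Sum>S\<in>balls n k. \<Sum>T\<in>B S - {S}. prob {\<omega>\<in>space P. same_box X S \<omega> \<and> same_box X T \<omega>})
      = (\<Sum>S\<in>balls n k. \<Sum>T\<in>B S - {S}. box_prob_moment P X (card (S \<union> T) - 1))"
  proof (intro sum.cong refl)
    fix S T assume S: "S \<in> balls n k" and T: "T \<in> B S - {S}"
    then have "S \<inter> T \<noteq> {}" by (auto simp: B_def)
    then show "prob {\<omega>\<in>space P. same_box X S \<omega> \<and> same_box X T \<omega>} = box_prob_moment P X (card (S \<union> T) - 1)"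
      unfolding same_box_Un[OF \<open>S \<inter> T \<noteq> {}\<close>] using sub[OF S] T
      by (intro prob_same_box) (auto simp: B_def balls_def)
  qed
  also have "\<dots> = (\<Sum>(S, T)\<in>Sigma (balls n k) (\<lambda>S. B S - {S}). box_prob_moment P X (card (S \<union> T) - 1))"
    by (rule sum.Sigma) (auto simp: BS)
  also have "exp (2 * l) * t\<^sup>2 * ((\<Sum>(S, T)\<in>Sigma (balls n k) B. (box_prob_moment P X (k - 1))\<^sup>2) + \<dots>)
    \<le> exp (2 * l) * t\<^sup>2 *
      ((\<Sum>u\<in>{k..<2 * k}. 4 ^ u * real (n choose u) * (box_prob_moment P X (k - 1))\<^sup>2)
       + (\<Sum>u\<in>{k<..<2 * k}. 4 ^ u * real (n choose u) * box_prob_moment P X (u - 1)))"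
  proof (intro mult_left_mono add_mono)
    show "(\<Sum>(S, T)\<in>Sigma (balls n k) B. (box_prob_moment P X (k - 1))\<^sup>2)
        \<le> (\<Sum>u\<in>{k..<2 * k}. 4 ^ u * real (n choose u) * (box_prob_moment P X (k - 1))\<^sup>2)"
      by (rule sum_pairs_le) (use card_Un in \<open>auto simp: B_def\<close>)
    show "(\<Sum>(S, T)\<in>Sigma (balls n k) (\<lambda>S. B S - {S}). box_prob_moment P X (card (S \<union> T) - 1))
        \<le> (\<Sum>u\<in>{k<..<2 * k}. 4 ^ u * real (n choose u) * box_prob_moment P X (u - 1))"
      by (rule sum_pairs_le) (use card_Un' in \<open>auto simp: B_def box_prob_moment_nonneg\<close>)
  qed auto
  finally show ?thesis .
qed

text \<open>The integrands differ only if some \<open>r + 2\<close> balls share a box, and then by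
  at most 2, the diameter of the unit circle. The expected number of such sets bounds the
  probability.\<close>

lemma char_overflow_diff_le:
  "cmod (char (distr P borel (\<lambda>\<omega>. real (overflow M X n r \<omega>))) t
      - char (distr P borel (\<lambda>\<omega>. \<Sum>S\<in>balls n (r + 1). of_bool (same_box X S \<omega>))) t)
    \<le> 2 * (real (n choose (r + 2)) * box_prob_moment P X (r + 1))"
proof -
  have meas[measurable]: "Measurable.pred P (same_box X S)" if "S \<in> balls n k" for S k
    using that by (auto simp: balls_def intro!: measurable_same_box)
  define W where "W \<omega> = (\<Sum>S\<in>balls n (r + 1). of_bool (same_box X S \<omega>) :: real)" for \<omega>
  have [measurable]: "W \<in> borel_measurable P" unfolding W_def by measurable
  define V where "V \<omega> = real (overflow M X n r \<omega>)" for \<omega>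
  have [measurable]: "V \<in> borel_measurable P" unfolding V_def by measurable
  have int: "integrable P (\<lambda>\<omega>. iexp (t * f \<omega>))" if [measurable]: "f \<in> borel_measurable P" for f
    by (intro integrable_const_bound[where B = 1]) auto
  have intI: "integrable P (\<lambda>\<omega>. of_bool (same_box X S \<omega>) :: real)" if "S \<in> balls n k" for S k
    using that by (intro integrable_const_bound[where B = 1]) auto
  have "cmod (char (distr P borel V) t - char (distr P borel W) t)
      = cmod (\<integral>\<omega>. iexp (t * V \<omega>) - iexp (t * W \<omega>) \<partial>P)"
    unfolding char_def using int[of V] int[of W] by (simp add: integral_distr)
  also have "\<dots> \<le> (\<integral>\<omega>. 2 * (\<Sum>S\<in>balls n (r + 2). of_bool (same_box X S \<omega>)) \<partial>P)"
  proof (rule norm_integral_le_integral)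
    fix \<omega> assume \<omega>: "\<omega> \<in> space P"
    show "cmod (iexp (t * V \<omega>) - iexp (t * W \<omega>)) \<le> 2 * (\<Sum>S\<in>balls n (r + 2). of_bool (same_box X S \<omega>))"
    proof (cases "\<exists>S\<in>balls n (r + 2). same_box X S \<omega>")
      case True
      then obtain S where S: "S \<in> balls n (r + 2)" "same_box X S \<omega>" by blast
      have "(\<Sum>S\<in>{S}. of_bool (same_box X S \<omega>)) \<le> (\<Sum>S\<in>balls n (r + 2). of_bool (same_box X S \<omega>) :: real)"
        using S by (intro sum_mono2) auto
      then have "1 \<le> (\<Sum>S\<in>balls n (r + 2). of_bool (same_box X S \<omega>) :: real)"
        using S by (simp del: sum_of_bool_eq)
      moreover have "cmod (iexp (t * V \<omega>) - iexp (t * W \<omega>)) \<le> 1 + 1"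
        by (rule order_trans[OF norm_triangle_ineq4]) simp
      ultimately show ?thesis by linarith
    next
      case False
      then have "V \<omega> = W \<omega>"
        using overflow_eq_card_same_box[OF \<omega>, of r] by (simp add: V_def W_def Int_def)
      then show ?thesis by (simp add: sum_nonneg del: sum_of_bool_eq)
    qed
  qed (use int[of V] int[of W] intI in \<open>auto simp del: sum_of_bool_eq\<close>)
  also have "\<dots> = 2 * (\<Sum>S\<in>balls n (r + 2). \<integral>\<omega>. of_bool (same_box X S \<omega>) \<partial>P)"
    using intI by (simp del: sum_of_bool_eq)
  also have "(\<Sum>S\<in>balls n (r + 2). \<integral>\<omega>. of_bool (same_box X S \<omega>) \<partial>P)
      = (\<Sum>S\<in>balls n (r + 2). box_prob_moment P X (r + 1))"
  proof (rule sum.cong[OF refl])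
    fix S assume S: "S \<in> balls n (r + 2)"
    have "(\<integral>\<omega>. of_bool (same_box X S \<omega>) \<partial>P) = expectation (indicator {\<omega>\<in>space P. same_box X S \<omega>})"
      by (intro Bochner_Integration.integral_cong) (auto simp: indicator_def)
    also have "\<dots> = prob {\<omega>\<in>space P. same_box X S \<omega>}"
      using S by simp
    also have "\<dots> = box_prob_moment P X (r + 1)"
      using S prob_same_box[of S] by (cases "S = {}") (auto simp: balls_def)
    finally show "(\<integral>\<omega>. of_bool (same_box X S \<omega>) \<partial>P) = box_prob_moment P X (r + 1)" .
  qed
  also have "\<dots> = real (n choose (r + 2)) * box_prob_moment P X (r + 1)"
    by (simp add: card_balls)
  finally show ?thesis by (simp add: V_def W_def del: sum_of_bool_eq)
qed

end

section \<open>Asymptotics and the limit law\<close>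

lemma binomial_over_power_limit:
  "(\<lambda>n. real (n choose k) / real n ^ k) \<longlonglongrightarrow> 1 / fact k"
proof -
  have "(\<lambda>n. (\<Prod>i=0..<k. 1 - real i / real n) / fact k) \<longlonglongrightarrow> (\<Prod>i=0..<k. 1 - 0) / fact k"
    by (intro tendsto_intros lim_const_over_n) auto
  moreover have "eventually (\<lambda>n. (\<Prod>i=0..<k. 1 - real i / real n) / fact k = real (n choose k) / real n ^ k) sequentially"
    using eventually_gt_at_top[of 0]
  proof eventually_elim
    case (elim n)
    have "real (n choose k) / real n ^ k = (\<Prod>i=0..<k. real n - real i) / (\<Prod>i=0..<k. real n) / fact k"
      by (simp add: binomial_gbinomial gbinomial_prod_rev)
    also have "(\<Prod>i=0..<k. real n - real i) / (\<Prod>i=0..<k. real n) = (\<Prod>i=0..<k. 1 - real i / real n)"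
      unfolding prod_dividef[symmetric] using elim by (intro prod.cong) (auto simp: diff_divide_distrib)
    finally show ?case by simp
  qed
  ultimately show ?thesis by (simp add: tendsto_cong)
qed

lemma binomial_le_real_pow: "real (n choose k) \<le> real n ^ k"
proof (cases "k \<le> n")
  case True
  then show ?thesis using binomial_le_pow[of k n] by (metis of_nat_le_iff of_nat_power)
qed (simp add: binomial_eq_0)

theorem theorem2p1:
  fixes P :: "nat \<Rightarrow> 'a measure"
    and M :: "nat \<Rightarrow> nat set"
    and X :: "nat \<Rightarrow> nat \<Rightarrow> 'a \<Rightarrow> nat"
    and r :: nat and \<mu> :: real
  assumes model: "\<And>n. n \<ge> 1 \<Longrightarrow> ball_allocation (P n) n (M n) (X n)"
    and r: "r \<ge> 1"
    and \<mu>: "\<mu> > 0"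
    and moment: "(\<lambda>n. real n ^ (r + 1) * box_prob_moment (P n) (X n) r)
                   \<longlonglongrightarrow> fact (r + 1) * \<mu>"
    and small: "(\<lambda>n. real n * max_box_prob (P n) (M n) (X n)) \<longlonglongrightarrow> 0"
  shows "weak_conv_m
           (\<lambda>n. distr (P n) borel (\<lambda>\<omega>. real (overflow (M n) (X n) n r \<omega>)))
           (distr (measure_pmf (poisson_pmf \<mu>)) borel real)"
proof -
  define \<pi> where "\<pi> n s = box_prob_moment (P n) (X n) s" for n s
  define a where "a n = real n ^ (r + 1) * \<pi> n r" for n
  define l where "l n = real (n choose (r + 1)) * \<pi> n r" for n
  define D where "D n = distr (P n) borel (\<lambda>\<omega>. real (overflow (M n) (X n) n r \<omega>))" for n
  note a = moment[folded \<pi>_def, folded a_def]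
  have \<pi>: "0 \<le> \<pi> n s" for n s
    unfolding \<pi>_def by (rule box_prob_moment_nonneg)
  \<comment> \<open>\<open>l n\<close> is the mean of W. The binomial coefficient is asymptotic to
    \<open>n ^ (r + 1) / fact (r + 1)\<close>, which cancels the factorial in the moment
    hypothesis.\<close>
  have "(\<lambda>n. (real (n choose (r + 1)) / real n ^ (r + 1)) * a n) \<longlonglongrightarrow> 1 / fact (r + 1) * (fact (r + 1) * \<mu>)"
    by (intro tendsto_mult binomial_over_power_limit a)
  moreover have "eventually (\<lambda>n. (real (n choose (r + 1)) / real n ^ (r + 1)) * a n = l n) sequentially"
    using eventually_gt_at_top[of 0] by eventually_elim (simp add: a_def l_def)
  ultimately have l: "l \<longlonglongrightarrow> \<mu>"
    by (simp add: tendsto_cong)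
  \<comment> \<open>Of the \<open>u\<close> powers of \<open>n\<close>, \<open>r + 1\<close> go into
    \<open>a n\<close> and the other \<open>u - 1 - r\<close> pair with factors
    \<open>max_box_prob\<close>. Since \<open>u \<ge> r + 2\<close>, at least one such pair is left,
    and it tends to 0.\<close>
  have lim1: "(\<lambda>n. real (n choose u) * \<pi> n (u - 1)) \<longlonglongrightarrow> 0" if u: "u \<ge> r + 2" for u
  proof (rule tendsto_sandwich[where f = "\<lambda>_. 0"])
    have "(\<lambda>n. (real n * max_box_prob (P n) (M n) (X n)) ^ (u - 1 - r) * a n)
        \<longlonglongrightarrow> 0 ^ (u - 1 - r) * (fact (r + 1) * \<mu>)"
      by (intro tendsto_intros small a)
    then show "(\<lambda>n. (real n * max_box_prob (P n) (M n) (X n)) ^ (u - 1 - r) * a n) \<longlonglongrightarrow> 0"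
      using u by (simp add: power_0_left)
    show "eventually (\<lambda>n. real (n choose u) * \<pi> n (u - 1)
        \<le> (real n * max_box_prob (P n) (M n) (X n)) ^ (u - 1 - r) * a n) sequentially"
      using eventually_ge_at_top[of 1]
    proof eventually_elim
      case (elim n)
      interpret ball_allocation "P n" n "M n" "X n" by (rule model) fact
      have u': "u - 1 = r + (u - 1 - r)" "u = (r + 1) + (u - 1 - r)" using u by auto
      have "real (n choose u) * \<pi> n (u - 1)
          \<le> real n ^ u * (max_box_prob (P n) (M n) (X n) ^ (u - 1 - r) * \<pi> n r)"
        using box_prob_moment_le[OF elim, of r "u - 1 - r", folded u'(1)] \<pi>
        by (intro mult_mono binomial_le_real_pow) (auto simp: \<pi>_def)
      also have "real n ^ u = real n ^ (r + 1) * real n ^ (u - 1 - r)"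
        by (subst u'(2)) (rule power_add)
      finally show ?case
        by (simp add: a_def power_mult_distrib mult_ac)
    qed
  qed (auto simp: \<pi>)
  \<comment> \<open>The square of \<open>a n\<close> carries \<open>2 * (r + 1)\<close> powers of
    \<open>n\<close>, one more than the binomial coefficient can use up.\<close>
  have lim2: "(\<lambda>n. real (n choose u) * (\<pi> n r)\<^sup>2) \<longlonglongrightarrow> 0" if u: "u < 2 * (r + 1)" for u
  proof (rule tendsto_sandwich[where f = "\<lambda>_. 0"])
    show "(\<lambda>n. (a n)\<^sup>2 * (1 / real n)) \<longlonglongrightarrow> 0"
      using tendsto_mult[OF tendsto_power[OF a, of 2] lim_const_over_n[of 1]] by simp
    show "eventually (\<lambda>n. real (n choose u) * (\<pi> n r)\<^sup>2 \<le> (a n)\<^sup>2 * (1 / real n)) sequentially"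
      using eventually_ge_at_top[of 1]
    proof eventually_elim
      case (elim n)
      have "real (n choose u) \<le> real n ^ (2 * r + 1)"
        using u elim by (intro order_trans[OF binomial_le_real_pow] power_increasing) auto
      then have "real (n choose u) * (\<pi> n r)\<^sup>2 \<le> real n ^ (2 * r + 1) * (\<pi> n r)\<^sup>2"
        by (rule mult_right_mono) simp
      also have "\<dots> = (a n)\<^sup>2 * (1 / real n)"
        using elim by (simp add: a_def power_add mult_2 power2_eq_square field_simps mult_2_right)
      finally show ?case .
    qed
  qed auto
  define err where "err t n =
      2 * (real (n choose (r + 2)) * \<pi> n (r + 1)) + exp (2 * l n) * t\<^sup>2 *
        ((\<Sum>u\<in>{r + 1..<2 * (r + 1)}. 4 ^ u * real (n choose u) * (\<pi> n r)\<^sup>2)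
         + (\<Sum>u\<in>{r + 1<..<2 * (r + 1)}. 4 ^ u * real (n choose u) * \<pi> n (u - 1)))" for t n
  have err_lim: "err t \<longlonglongrightarrow> 0" for t
  proof -
    have "(\<lambda>n. \<Sum>u\<in>{r + 1..<2 * (r + 1)}. 4 ^ u * real (n choose u) * (\<pi> n r)\<^sup>2) \<longlonglongrightarrow> 0"
      unfolding mult.assoc by (intro tendsto_null_sum tendsto_mult_right_zero lim2) auto
    moreover have "(\<lambda>n. \<Sum>u\<in>{r + 1<..<2 * (r + 1)}. 4 ^ u * real (n choose u) * \<pi> n (u - 1)) \<longlonglongrightarrow> 0"
      unfolding mult.assoc by (intro tendsto_null_sum tendsto_mult_right_zero lim1) auto
    moreover have "(\<lambda>n. real (n choose (r + 2)) * \<pi> n (r + 1)) \<longlonglongrightarrow> 0"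
      using lim1[of "r + 2"] by simp
    ultimately have "err t \<longlonglongrightarrow> 2 * 0 + exp (2 * \<mu>) * t\<^sup>2 * (0 + 0)"
      unfolding err_def[abs_def] by (intro tendsto_intros l)
    then show ?thesis by simp
  qed
  have char_bound: "cmod (char (D n) t - exp (of_real (l n) * (iexp t - 1))) \<le> err t n" if "n \<ge> 1" for n t
  proof -
    interpret ball_allocation "P n" n "M n" "X n" by (rule model) fact
    show ?thesis
      using norm_triangle_mono[OF char_overflow_diff_le[of r t] char_same_box_count_bound[of "r + 1" t]]
      by (simp add: D_def err_def \<pi>_def l_def del: sum_of_bool_eq)
  qed
  have char_lim: "(\<lambda>n. char (D n) t) \<longlonglongrightarrow> char (distr (measure_pmf (poisson_pmf \<mu>)) borel real) t" for t
  proof -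
    have "(\<lambda>n. char (D n) t - exp (of_real (l n) * (iexp t - 1))) \<longlonglongrightarrow> 0"
      by (rule Lim_null_comparison[OF eventually_mono[OF eventually_ge_at_top[of 1] char_bound] err_lim])
    moreover have "(\<lambda>n. exp (of_real (l n) * (iexp t - 1))) \<longlonglongrightarrow> exp (of_real \<mu> * (iexp t - 1))"
      by (intro tendsto_intros l)
    ultimately show ?thesis
      unfolding char_poisson[OF \<mu>] using tendsto_add by fastforce
  qed
  \<comment> \<open>The model is assumed for \<open>n \<ge> 1\<close> only, whereas the continuity
    theorem wants every member of the sequence to be a distribution; shifting the index skips row
    0.\<close>
  have "weak_conv_m (\<lambda>n. D (Suc n)) (distr (measure_pmf (poisson_pmf \<mu>)) borel real)"
  proof (rule levy_continuity)
    show "real_distribution (D (Suc n))" for n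
    proof -
      interpret ball_allocation "P (Suc n)" "Suc n" "M (Suc n)" "X (Suc n)" by (rule model) simp
      show ?thesis unfolding D_def by (rule real_distribution_distr) measurable
    qed
    show "real_distribution (distr (measure_pmf (poisson_pmf \<mu>)) borel real)"
      by (rule prob_space.real_distribution_distr) (auto simp: prob_space_measure_pmf)
    show "(\<lambda>n. char (D (Suc n)) t) \<longlonglongrightarrow> char (distr (measure_pmf (poisson_pmf \<mu>)) borel real) t" for t
      using char_lim by (rule LIMSEQ_Suc)
  qed
  then show ?thesis
    unfolding weak_conv_m_def weak_conv_def D_def[symmetric]
    by (simp add: filterlim_sequentially_Suc[of "\<lambda>n. cdf (D n) x" for x])
qed

end
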